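(* Let $X\subset\mathbb{R}^2$ be a connected open set with coordinates $(x^1,x^2)$. Let $\omega=(\omega_{ij})$, $\omega_{ij}=\omega_{ji}$, be a smooth section of $S_2T^*$ with $\det(\omega)\neq 0$ everywhere on $X$, and let $\gamma=(\gamma^k_{ij})$, $\gamma^k_{ij}=\gamma^k_{ji}$, be a smooth torsion-free affine connection on $X$ (a priori independent of $\omega$). Suppose that the linear system of infinitesimal Lie equations $\Omega_{ij}=0$, $\Gamma^k_{ij}=0$ determined by $(\omega,\gamma)$ is formally integrable, in the sense that every linear equation of order at most $1$ on $\xi$ obtained from it by finitely many differentiations and linear combinations is already a consequence of the first order equations $\Omega_{ij}=0$ (in particular there is no equation of order zero). Then there exist two constants $c_1,c_2\in\mathbb{R}$ (the Vessiot structure constants) such that the following Vessiot structure equations hold on $X$: $$\tfrac12(\rho_{ij}+\rho_{ji})=c_1\,\omega_{ij}\quad (1\le i,j\le 2),\qquad \tfrac12(\rho_{12}-\rho_{21})=c_2\,|\det(\omega)|^{1/2}.$$ Moreover, if $\gamma$ is the Levi-Civita connection of $\omega$, then $c_2=0$, the tensor $(\rho_{ij})$ is symmetric, and the structure equations reduce to the constant curvature condition $\rho_{ij}=c_1\,\omega_{ij}$.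
   Context: Here $T$ is the tangent bundle of $X$, $T^*$ its dual, $S_2T^*$ the bundle of symmetric covariant 2-tensors, $\partial_i=\partial/\partial x^i$, repeated indices are summed over $\{1,2\}$, and $\det(\omega)=\omega_{11}\omega_{22}-(\omega_{12})^2$. The Levi-Civita connection of $\omega$ is $\gamma^k_{ij}=\frac12\omega^{kr}(\partial_i\omega_{rj}+\partial_j\omega_{ir}-\partial_r\omega_{ij})$, with $(\omega^{ij})$ the inverse matrix of $(\omega_{ij})$. The unknown of the system is a vector field $\xi=(\xi^1,\xi^2)$, with jet coordinates $\xi^k,\xi^k_i,\xi^k_{ij}$ representing $\xi^k,\partial_i\xi^k,\partial_{ij}\xi^k$. The infinitesimal Lie equations are the vanishing of the Lie derivatives of $\omega$ and $\gamma$, namely $$\Omega_{ij}\equiv\omega_{rj}\xi^r_i+\omega_{ir}\xi^r_j+\xi^r\partial_r\omega_{ij}=0,$$ $$\Gamma^k_{ij}\equiv\xi^k_{ij}+\gamma^k_{rj}\xi^r_i+\gamma^k_{ir}\xi^r_j-\gamma^r_{ij}\xi^k_r+\xi^r\partial_r\gamma^k_{ij}=0.$$ The curvature of $\gamma$ and its Ricci contraction (not necessarily symmetric) are $$\rho^k_{l,ij}=\partial_i\gamma^k_{lj}-\partial_j\gamma^k_{li}+\gamma^r_{lj}\gamma^k_{ri}-\gamma^r_{li}\gamma^k_{rj},\qquad \rho_{ij}=\rho^r_{i,rj}.$$ *)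

theory Defs
  imports "HOL-Analysis.Analysis" "HOL-Library.Multiset"
begin

text \<open>
  Coordinates on the plane are indexed by the two-element type \<^typ>\<open>2\<close>, whose elements are
  \<open>1\<close> and \<open>2\<close>. Objects on \<open>X\<close> are total functions of \<^typ>\<open>real^2\<close>
  of which only the values on \<open>X\<close> matter; since \<open>X\<close> is open, so do only these values
  for the derivatives at points of \<open>X\<close>.
\<close>

definition pd :: "2 \<Rightarrow> (real^2 \<Rightarrow> real) \<Rightarrow> real^2 \<Rightarrow> real" where
  "pd i f x = frechet_derivative f (at x) (axis i 1)"

text \<open>For open \<open>X\<close> this is the usual \<open>C\<close>-infinity: every iterated partial derivative
  exists and is differentiable, hence continuous, on \<open>X\<close>.\<close>

definition smooth_on :: "(real^2) set \<Rightarrow> (real^2 \<Rightarrow> real) \<Rightarrow> bool" where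
  "smooth_on X f \<longleftrightarrow> (\<forall>is. \<forall>x\<in>X. foldr pd is f differentiable (at x))"

type_synonym sym2 = "2 \<Rightarrow> 2 \<Rightarrow> real^2 \<Rightarrow> real"

text \<open>\<open>\<gamma> k i j x\<close> is the coefficient of \<open>\<gamma>\<close> at \<open>x\<close> with upper index \<open>k\<close>
  and lower indices \<open>i\<close>, \<open>j\<close>.\<close>

type_synonym connection = "2 \<Rightarrow> 2 \<Rightarrow> 2 \<Rightarrow> real^2 \<Rightarrow> real"

definition mat_of :: "sym2 \<Rightarrow> real^2 \<Rightarrow> real^2^2" where
  "mat_of \<omega> x = (\<chi> i j. \<omega> i j x)"

definition levi_civita :: "sym2 \<Rightarrow> connection" where
  "levi_civita \<omega> k i j x = 1/2 * (\<Sum>r\<in>UNIV. matrix_inv (mat_of \<omega> x) $ k $ r *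
     (pd i (\<omega> r j) x + pd j (\<omega> i r) x - pd r (\<omega> i j) x))"

text \<open>\<open>curvature \<gamma> k l i j\<close> has upper index \<open>k\<close>, then \<open>l\<close>, then the
  antisymmetric pair \<open>i\<close>, \<open>j\<close>.\<close>

definition curvature :: "connection \<Rightarrow> 2 \<Rightarrow> 2 \<Rightarrow> 2 \<Rightarrow> 2 \<Rightarrow> real^2 \<Rightarrow> real" where
  "curvature \<gamma> k l i j x = pd i (\<gamma> k l j) x - pd j (\<gamma> k l i) x
     + (\<Sum>r\<in>UNIV. \<gamma> r l j x * \<gamma> k r i x - \<gamma> r l i x * \<gamma> k r j x)"

definition ricci :: "connection \<Rightarrow> 2 \<Rightarrow> 2 \<Rightarrow> real^2 \<Rightarrow> real" where
  "ricci \<gamma> i j x = (\<Sum>r\<in>UNIV. curvature \<gamma> r i r j x)"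

text \<open>
  A (formal, infinite) jet \<open>u\<close> assigns a value to every jet coordinate of the unknown vector
  field: \<open>u k {#}\<close>, \<open>u k {#i#}\<close>, \<open>u k {#i, j#}\<close> stand for the value of the
  \<open>k\<close>-th component and of its first and second derivatives. Indexing by multisets builds in
  the symmetry of higher derivatives. A linear partial differential equation is represented by its
  left-hand side, a function of the base point and of the jet, linear in the jet.
\<close>

type_synonym jet = "2 \<Rightarrow> 2 multiset \<Rightarrow> real"
type_synonym equation = "real^2 \<Rightarrow> jet \<Rightarrow> real"

definition lie_metric :: "sym2 \<Rightarrow> 2 \<Rightarrow> 2 \<Rightarrow> equation" where
  "lie_metric \<omega> i j x u = (\<Sum>r\<in>UNIV.
     \<omega> r j x * u r {#i#} + \<omega> i r x * u r {#j#} + u r {#} * pd r (\<omega> i j) x)"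

definition lie_connection :: "connection \<Rightarrow> 2 \<Rightarrow> 2 \<Rightarrow> 2 \<Rightarrow> equation" where
  "lie_connection \<gamma> k i j x u = u k {#i, j#} + (\<Sum>r\<in>UNIV.
     \<gamma> k r j x * u r {#i#} + \<gamma> k i r x * u r {#j#} - \<gamma> r i j x * u k {#r#}
     + u r {#} * pd r (\<gamma> k i j) x)"

text \<open>
  Formal (total) derivative with respect to the \<open>i\<close>-th coordinate: differentiate the
  coefficients, and replace every jet coordinate by its \<open>i\<close>-th derivative. The formula is
  the total derivative because the equations it is applied to are linear in the jet.
\<close>

definition formal_deriv :: "2 \<Rightarrow> equation \<Rightarrow> equation" where
  "formal_deriv i \<Phi> x u = pd i (\<lambda>y. \<Phi> y u) x + \<Phi> x (\<lambda>k M. u k (add_mset i M))"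

text \<open>All equations obtained from the system by finitely many differentiations and linear
  combinations over the smooth functions on \<open>X\<close>.\<close>

inductive derived_eq :: "(real^2) set \<Rightarrow> sym2 \<Rightarrow> connection \<Rightarrow> equation \<Rightarrow> bool"
  for X \<omega> \<gamma> where
  metric: "derived_eq X \<omega> \<gamma> (lie_metric \<omega> i j)"
| connection: "derived_eq X \<omega> \<gamma> (lie_connection \<gamma> k i j)"
| differentiate: "derived_eq X \<omega> \<gamma> \<Phi> \<Longrightarrow> derived_eq X \<omega> \<gamma> (formal_deriv i \<Phi>)"
| add: "derived_eq X \<omega> \<gamma> \<Phi> \<Longrightarrow> derived_eq X \<omega> \<gamma> \<Psi> \<Longrightarrow>
    derived_eq X \<omega> \<gamma> (\<lambda>x u. \<Phi> x u + \<Psi> x u)"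
| scale: "smooth_on X f \<Longrightarrow> derived_eq X \<omega> \<gamma> \<Phi> \<Longrightarrow>
    derived_eq X \<omega> \<gamma> (\<lambda>x u. f x * \<Phi> x u)"

definition order_le :: "(real^2) set \<Rightarrow> nat \<Rightarrow> equation \<Rightarrow> bool" where
  "order_le X q \<Phi> \<longleftrightarrow> (\<forall>x\<in>X. \<forall>u v.
     (\<forall>k M. size M \<le> q \<longrightarrow> u k M = v k M) \<longrightarrow> \<Phi> x u = \<Phi> x v)"

text \<open>\<open>\<Phi>\<close> vanishes on every jet, at every point of \<open>X\<close>, that satisfies the first order
  equations there. By linearity this says that \<open>\<Phi>\<close> is, at each point, a linear combination
  of them.\<close>

definition consequence_of_metric :: "(real^2) set \<Rightarrow> sym2 \<Rightarrow> equation \<Rightarrow> bool" where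
  "consequence_of_metric X \<omega> \<Phi> \<longleftrightarrow>
     (\<forall>x\<in>X. \<forall>u. (\<forall>i j. lie_metric \<omega> i j x u = 0) \<longrightarrow> \<Phi> x u = 0)"

definition formally_integrable :: "(real^2) set \<Rightarrow> sym2 \<Rightarrow> connection \<Rightarrow> bool" where
  "formally_integrable X \<omega> \<gamma> \<longleftrightarrow>
     (\<forall>\<Phi>. derived_eq X \<omega> \<gamma> \<Phi> \<and> order_le X 1 \<Phi> \<longrightarrow> consequence_of_metric X \<omega> \<Phi>)"

end

theory Submission
  imports Defs
begin

text \<open>
  Differentiating the equations \<open>\<Gamma> = 0\<close> once and forming the linearised curvature combination cancels
  all jets of order at least 2, by naturality: what remains is the Lie derivative of the curvature
  of \<open>\<gamma>\<close>, a first order equation. Formal integrability makes its contraction, the Lie derivative of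
  the Ricci tensor, vanish on every 1-jet that annihilates \<open>\<omega>\<close>. Those with \<open>\<xi> = 0\<close> form the
  orthogonal Lie algebra of \<open>\<omega>\<close>, so the symmetric part of the Ricci tensor is \<open>f \<omega>\<close> for a function \<open>f\<close>.
  Since \<open>\<omega>\<close> is nondegenerate, the value \<open>\<xi>\<close> of such a 1-jet is arbitrary; this makes the derivatives
  of \<open>f\<close> and of \<open>(\<rho>\<^sub>1\<^sub>2 - \<rho>\<^sub>2\<^sub>1) / (2 \<bar>det \<omega>\<bar>\<^sup>1\<^sup>/\<^sup>2)\<close> vanish. For the Levi-Civita connection
  the skew part of the Ricci tensor is the exterior derivative of the exact form \<open>d log \<bar>det \<omega>\<bar>\<^sup>1\<^sup>/\<^sup>2\<close>, up to sign.
\<close>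

section \<open>Partial derivatives and smooth functions\<close>

lemma has_derivative_pd:
  assumes "f differentiable at x"
  shows "(f has_derivative (\<lambda>h. \<Sum>i\<in>UNIV. h $ i * pd i f x)) (at x)"
proof -
  have lin: "linear (frechet_derivative f (at x))"
    using assms by (rule linear_frechet_derivative)
  have "frechet_derivative f (at x) h = (\<Sum>i\<in>UNIV. h $ i * pd i f x)" for h
  proof -
    have "h = h $ 1 *\<^sub>R axis 1 1 + h $ 2 *\<^sub>R axis 2 1"
      by (simp add: vec_eq_iff forall_2 axis_def)
    then have "frechet_derivative f (at x) h
        = frechet_derivative f (at x) (h $ 1 *\<^sub>R axis 1 1 + h $ 2 *\<^sub>R axis 2 1)"
      by simp
    then show ?thesis
      by (simp add: linear_add[OF lin] linear_cmul[OF lin] sum_2 pd_def)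
  qed
  then have "frechet_derivative f (at x) = (\<lambda>h. \<Sum>i\<in>UNIV. h $ i * pd i f x)" by auto
  then show ?thesis
    using assms frechet_derivative_works by metis
qed

lemma pd_const [simp]: "pd i (\<lambda>x. c) = (\<lambda>x. 0)"
  by (simp add: pd_def fun_eq_iff)

lemma pd_add:
  "\<lbrakk>f differentiable at x; g differentiable at x\<rbrakk>
    \<Longrightarrow> pd i (\<lambda>y. f y + g y) x = pd i f x + pd i g x"
  unfolding frechet_derivative_works pd_def
  by (metis (mono_tags, lifting) frechet_derivative_at has_derivative_add)

lemma pd_diff:
  "\<lbrakk>f differentiable at x; g differentiable at x\<rbrakk>
    \<Longrightarrow> pd i (\<lambda>y. f y - g y) x = pd i f x - pd i g x"
  unfolding frechet_derivative_works pd_def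
  by (metis (mono_tags, lifting) frechet_derivative_at has_derivative_diff)

lemma pd_mult:
  "\<lbrakk>f differentiable at x; g differentiable at x\<rbrakk>
    \<Longrightarrow> pd i (\<lambda>y. f y * g y) x = f x * pd i g x + pd i f x * g x"
  unfolding frechet_derivative_works pd_def
  by (metis (mono_tags, lifting) frechet_derivative_at has_derivative_mult)

lemma pd_cong_open:
  assumes "open X" "x \<in> X" "\<And>y. y \<in> X \<Longrightarrow> f y = g y"
  shows "pd i f x = pd i g x"
proof -
  have "(f has_derivative F) (at x) \<longleftrightarrow> (g has_derivative F) (at x)" for F
    using has_derivative_transform_within_open[OF _ assms(1,2), of f F UNIV g]
      has_derivative_transform_within_open[OF _ assms(1,2), of g F UNIV f] assms(3) by metis
  then show ?thesis
    by (simp add: pd_def frechet_derivative_def)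
qed

lemma smooth_on_differentiable: "\<lbrakk>smooth_on X f; x \<in> X\<rbrakk> \<Longrightarrow> f differentiable at x"
  unfolding smooth_on_def by (metis foldr.simps(1) id_apply)

lemma smooth_on_pd: "smooth_on X f \<Longrightarrow> smooth_on X (pd i f)"
  unfolding smooth_on_def
proof (intro allI ballI)
  fix js x assume "\<forall>is. \<forall>x\<in>X. foldr pd is f differentiable at x" "x \<in> X"
  then have "foldr pd (js @ [i]) f differentiable at x" by blast
  then show "foldr pd js (pd i f) differentiable at x" by simp
qed

lemma smooth_on_const: "smooth_on X (\<lambda>x. c)"
proof -
  have "\<exists>d. foldr pd is (\<lambda>x. c) = (\<lambda>x. d)" for "is"
    by (induction "is") auto
  then show ?thesis unfolding smooth_on_def
    by (metis differentiable_const)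
qed

section \<open>Symmetry of second partial derivatives\<close>

lemma has_real_derivative_pd:
  assumes "f differentiable at (p + s *\<^sub>R axis i 1)"
  shows "((\<lambda>s. f (p + s *\<^sub>R axis i 1)) has_real_derivative pd i f (p + s *\<^sub>R axis i 1)) (at s)"
proof -
  let ?F = "frechet_derivative f (at (p + s *\<^sub>R axis i 1))"
  have "((\<lambda>s. p + s *\<^sub>R axis i 1) has_derivative (\<lambda>h. h *\<^sub>R axis i 1)) (at s)"
    by (auto intro!: derivative_eq_intros)
  moreover have "(f has_derivative ?F) (at (p + s *\<^sub>R axis i 1))"
    using assms frechet_derivative_works by blast
  ultimately have "((\<lambda>s. f (p + s *\<^sub>R axis i 1)) has_derivative (\<lambda>h. ?F (h *\<^sub>R axis i 1))) (at s)"
    using diff_chain_at by (fastforce simp: o_def)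
  moreover have "?F (h *\<^sub>R axis i 1) = pd i f (p + s *\<^sub>R axis i 1) * h" for h
    by (simp add: linear_cmul[OF linear_frechet_derivative[OF assms]] pd_def)
  ultimately show ?thesis by (simp add: has_field_derivative_def)
qed

text \<open>The mean value theorem is applied along \<open>i\<close>, then along \<open>j\<close>.
  The second difference itself does not depend on the order of the two directions, whereas the
  resulting mixed derivative does; this yields Schwarz's theorem below.\<close>

lemma second_difference_pd:
  assumes smooth: "smooth_on X f" and d: "d > 0"
    and sq: "\<And>s t. \<lbrakk>0 \<le> s; s \<le> d; 0 \<le> t; t \<le> d\<rbrakk>
      \<Longrightarrow> x + s *\<^sub>R axis i 1 + t *\<^sub>R axis j 1 \<in> X"
  obtains s t where "0 \<le> s" "s \<le> d" "0 \<le> t" "t \<le> d"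
    and "f (x + d *\<^sub>R axis i 1 + d *\<^sub>R axis j 1) - f (x + d *\<^sub>R axis i 1)
       - f (x + d *\<^sub>R axis j 1) + f x
       = d * d * pd j (pd i f) (x + s *\<^sub>R axis i 1 + t *\<^sub>R axis j 1)"
proof -
  let ?i = "axis i (1::real) :: real^2" and ?j = "axis j (1::real) :: real^2"
  define g where "g s = f ((x + d *\<^sub>R ?j) + s *\<^sub>R ?i) - f (x + s *\<^sub>R ?i)" for s
  define g' where "g' s = pd i f ((x + d *\<^sub>R ?j) + s *\<^sub>R ?i) - pd i f (x + s *\<^sub>R ?i)" for s
  have "(g has_real_derivative g' s) (at s)" if "0 \<le> s" "s \<le> d" for s
  proof -
    have "(x + d *\<^sub>R ?j) + s *\<^sub>R ?i \<in> X" "x + s *\<^sub>R ?i \<in> X"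
      using sq[OF that, of d] sq[OF that, of 0] d by (auto simp: algebra_simps)
    then show ?thesis unfolding g_def g'_def
      by (intro DERIV_diff has_real_derivative_pd smooth_on_differentiable[OF smooth])
  qed
  from MVT2[OF d this] obtain s where s: "0 < s" "s < d" "g d - g 0 = d * g' s" by auto
  have "((\<lambda>t. pd i f ((x + s *\<^sub>R ?i) + t *\<^sub>R ?j)) has_real_derivative
      pd j (pd i f) ((x + s *\<^sub>R ?i) + t *\<^sub>R ?j)) (at t)" if "0 \<le> t" "t \<le> d" for t
    using sq[OF _ _ that, of s] s
    by (intro has_real_derivative_pd smooth_on_differentiable[OF smooth_on_pd[OF smooth]]) auto
  from MVT2[OF d this] obtain t where t: "0 < t" "t < d"
    "pd i f ((x + s *\<^sub>R ?i) + d *\<^sub>R ?j) - pd i f ((x + s *\<^sub>R ?i) + 0 *\<^sub>R ?j)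
      = d * pd j (pd i f) ((x + s *\<^sub>R ?i) + t *\<^sub>R ?j)" by auto
  have "g' s = d * pd j (pd i f) (x + s *\<^sub>R ?i + t *\<^sub>R ?j)"
    using t(3) by (simp add: g'_def algebra_simps)
  then have "g d - g 0 = d * d * pd j (pd i f) (x + s *\<^sub>R ?i + t *\<^sub>R ?j)"
    using s(3) by simp
  moreover have "g d - g 0 = f (x + d *\<^sub>R ?i + d *\<^sub>R ?j) - f (x + d *\<^sub>R ?i)
       - f (x + d *\<^sub>R ?j) + f x"
    by (simp add: g_def algebra_simps)
  ultimately show ?thesis using that[of s t] s t by auto
qed

lemma pd_commute:
  assumes smooth: "smooth_on X f" and "open X" "x \<in> X"
  shows "pd i (pd j f) x = pd j (pd i f) x"
proof (rule ccontr)
  assume neq: "pd i (pd j f) x \<noteq> pd j (pd i f) x"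
  let ?i = "axis i (1::real) :: real^2" and ?j = "axis j (1::real) :: real^2"
  \<comment> \<open>Half the supposed gap: two equal numbers, each strictly within \<open>e\<close>
    of one of the two mixed derivatives at \<open>x\<close>, are then impossible.\<close>
  define e where "e = \<bar>pd i (pd j f) x - pd j (pd i f) x\<bar> / 2"
  have "e > 0" using neq by (simp add: e_def)
  have cont: "isCont (pd k (pd l f)) x" for k l
    using smooth_on_differentiable[OF smooth_on_pd[OF smooth_on_pd[OF smooth]] \<open>x \<in> X\<close>]
      differentiable_imp_continuous_within by blast
  obtain r1 where r1: "r1 > 0" "ball x r1 \<subseteq> X"
    using assms openE by blast
  obtain r2 where r2: "r2 > 0"
    "\<And>y. dist y x < r2 \<Longrightarrow> dist (pd i (pd j f) y) (pd i (pd j f) x) < e"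
    using cont[of i j] \<open>e > 0\<close> unfolding continuous_at_eps_delta by blast
  obtain r3 where r3: "r3 > 0"
    "\<And>y. dist y x < r3 \<Longrightarrow> dist (pd j (pd i f) y) (pd j (pd i f) x) < e"
    using cont[of j i] \<open>e > 0\<close> unfolding continuous_at_eps_delta by blast
  \<comment> \<open>Points of the square of side \<open>d\<close> lie within \<open>2 * d\<close> of
    \<open>x\<close>, hence inside all three balls.\<close>
  define d where "d = min r1 (min r2 r3) / 3"
  have d: "d > 0" "2 * d < r1" "2 * d < r2" "2 * d < r3"
    using r1 r2 r3 by (auto simp: d_def)
  have near: "dist (x + s *\<^sub>R axis k 1 + t *\<^sub>R axis l 1) x \<le> 2 * d"
    if "0 \<le> s" "s \<le> d" "0 \<le> t" "t \<le> d" for s t and k l :: 2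
  proof -
    have "norm (s *\<^sub>R axis k 1 + t *\<^sub>R axis l 1 :: real^2) \<le> \<bar>s\<bar> + \<bar>t\<bar>"
      by (rule order_trans[OF norm_triangle_ineq]) (simp add: norm_axis_1)
    then show ?thesis using that by (simp add: dist_norm add.assoc)
  qed
  have inX: "x + s *\<^sub>R axis k 1 + t *\<^sub>R axis l 1 \<in> X"
    if "0 \<le> s" "s \<le> d" "0 \<le> t" "t \<le> d" for s t and k l :: 2
    using near[OF that, of k l] d r1 by (auto simp: dist_commute)
  obtain s t where st: "0 \<le> s" "s \<le> d" "0 \<le> t" "t \<le> d"
    "f (x + d *\<^sub>R ?i + d *\<^sub>R ?j) - f (x + d *\<^sub>R ?i) - f (x + d *\<^sub>R ?j) + f x
       = d * d * pd j (pd i f) (x + s *\<^sub>R ?i + t *\<^sub>R ?j)"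
    by (rule second_difference_pd[OF smooth d(1) inX[of _ _ i j]])
  \<comment> \<open>The same second difference with the two directions exchanged.\<close>
  obtain s' t' where st': "0 \<le> s'" "s' \<le> d" "0 \<le> t'" "t' \<le> d"
    "f (x + d *\<^sub>R ?j + d *\<^sub>R ?i) - f (x + d *\<^sub>R ?j) - f (x + d *\<^sub>R ?i) + f x
       = d * d * pd i (pd j f) (x + s' *\<^sub>R ?j + t' *\<^sub>R ?i)"
    by (rule second_difference_pd[OF smooth d(1) inX[of _ _ j i]])
  have "d * d * pd j (pd i f) (x + s *\<^sub>R ?i + t *\<^sub>R ?j)
      = d * d * pd i (pd j f) (x + s' *\<^sub>R ?j + t' *\<^sub>R ?i)"
    using st(5) st'(5) by (simp add: algebra_simps)
  then have "pd j (pd i f) (x + s *\<^sub>R ?i + t *\<^sub>R ?j) = pd i (pd j f) (x + s' *\<^sub>R ?j + t' *\<^sub>R ?i)"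
    using d by simp
  moreover have "dist (pd i (pd j f) (x + s' *\<^sub>R ?j + t' *\<^sub>R ?i)) (pd i (pd j f) x) < e"
    using near[OF st'(1-4)] d by (intro r2(2)) (meson order_le_less_trans)
  moreover have "dist (pd j (pd i f) (x + s *\<^sub>R ?i + t *\<^sub>R ?j)) (pd j (pd i f) x) < e"
    using near[OF st(1-4)] d by (intro r3(2)) (meson order_le_less_trans)
  ultimately show False unfolding e_def dist_real_def by (smt (verit) field_sum_of_halves)
qed

section \<open>Lie derivatives of the curvature and of the Ricci tensor\<close>

lemma formal_deriv_lie_connection:
  assumes smooth: "\<And>k i j. smooth_on X (\<gamma> k i j)" and x: "x \<in> X"
  shows "formal_deriv m (lie_connection \<gamma> k i j) x u =
    u k {#m, i, j#} + (\<Sum>r\<in>UNIV.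
     pd m (\<gamma> k r j) x * u r {#i#} + pd m (\<gamma> k i r) x * u r {#j#} - pd m (\<gamma> r i j) x * u k {#r#}
     + u r {#} * pd m (pd r (\<gamma> k i j)) x
     + \<gamma> k r j x * u r {#m, i#} + \<gamma> k i r x * u r {#m, j#} - \<gamma> r i j x * u k {#m, r#}
     + u r {#m#} * pd r (\<gamma> k i j) x)"
proof -
  note [simp] = smooth_on_differentiable[OF smooth x]
    smooth_on_differentiable[OF smooth_on_pd[OF smooth] x]
  show ?thesis
    unfolding formal_deriv_def lie_connection_def sum_2
    by (simp add: pd_add pd_diff pd_mult)
qed

text \<open>The left side is the linearisation of \<open>curvature\<close> at
  \<open>\<gamma>\<close>, evaluated on the variation \<open>lie_connection \<gamma>\<close>. Third
  order jets cancel because multisets make them symmetric; second order jets from the total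
  derivatives cancel against those in the sum over \<open>s\<close>.\<close>

lemma lie_curvature:
  assumes smooth: "\<And>k i j. smooth_on X (\<gamma> k i j)" and X: "open X" and x: "x \<in> X"
  shows "formal_deriv i (lie_connection \<gamma> k l j) x u - formal_deriv j (lie_connection \<gamma> k l i) x u
     + (\<Sum>s\<in>UNIV. \<gamma> k s i x * lie_connection \<gamma> s l j x u + \<gamma> s l j x * lie_connection \<gamma> k s i x u
        - \<gamma> k s j x * lie_connection \<gamma> s l i x u - \<gamma> s l i x * lie_connection \<gamma> k s j x u)
     = (\<Sum>r\<in>UNIV. curvature \<gamma> k r i j x * u r {#l#} + curvature \<gamma> k l r j x * u r {#i#}
         + curvature \<gamma> k l i r x * u r {#j#} - curvature \<gamma> r l i j x * u k {#r#}
         + u r {#} * pd r (curvature \<gamma> k l i j) x)"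
proof -
  note [simp] = smooth_on_differentiable[OF smooth x]
    smooth_on_differentiable[OF smooth_on_pd[OF smooth] x]
  \<comment> \<open>Mixed derivatives are commuted so that \<open>i\<close> or \<open>j\<close> is
    outermost, as in the formal derivatives of the equations.\<close>
  have 1: "pd r (curvature \<gamma> k l i j) x = pd i (pd r (\<gamma> k l j)) x - pd j (pd r (\<gamma> k l i)) x
     + (\<Sum>s\<in>UNIV. pd r (\<gamma> s l j) x * \<gamma> k s i x + \<gamma> s l j x * pd r (\<gamma> k s i) x
         - pd r (\<gamma> s l i) x * \<gamma> k s j x - \<gamma> s l i x * pd r (\<gamma> k s j) x)" for r
    unfolding curvature_def[abs_def] sum_2
    by (simp add: pd_add pd_diff pd_mult pd_commute[OF smooth X x, of r])
  show ?thesis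
    unfolding 1 formal_deriv_lie_connection[OF smooth x]
    unfolding lie_connection_def curvature_def sum_2
    by (simp add: algebra_simps add_mset_commute)
qed

lemma derived_eq_diff:
  assumes "derived_eq X \<omega> \<gamma> \<Phi>" "derived_eq X \<omega> \<gamma> \<Psi>"
  shows "derived_eq X \<omega> \<gamma> (\<lambda>x u. \<Phi> x u - \<Psi> x u)"
  using derived_eq.add[OF assms(1) derived_eq.scale[OF smooth_on_const[of X "-1"] assms(2)]] by simp

lemma derived_eq_sum:
  fixes \<Phi> :: "2 \<Rightarrow> equation"
  assumes "\<And>s. derived_eq X \<omega> \<gamma> (\<Phi> s)"
  shows "derived_eq X \<omega> \<gamma> (\<lambda>x u. \<Sum>s\<in>UNIV. \<Phi> s x u)"
  unfolding sum_2 by (intro derived_eq.add assms)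

lemma curvature_differentiable:
  assumes smooth: "\<And>k i j. smooth_on X (\<gamma> k i j)" and x: "x \<in> X"
  shows "curvature \<gamma> k l i j differentiable at x"
proof -
  note [simp] = smooth_on_differentiable[OF smooth x]
    smooth_on_differentiable[OF smooth_on_pd[OF smooth] x]
  show ?thesis
    unfolding curvature_def[abs_def] sum_2 by simp
qed

lemma ricci_differentiable:
  assumes "\<And>k i j. smooth_on X (\<gamma> k i j)" and "x \<in> X"
  shows "ricci \<gamma> i j differentiable at x"
  unfolding ricci_def[abs_def] sum_2
  by (intro differentiable_add curvature_differentiable[OF assms])

text \<open>\<open>lie_metric\<close> is the Lie derivative of any covariant 2-tensor, so it applies
  to \<open>ricci \<gamma>\<close> as well. Contracting the identity of \<open>lie_curvature\<close>
  over its upper index and its index \<open>i\<close> makes the terms in which these two are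
  differentiated cancel.\<close>

lemma lie_ricci_consequence:
  assumes smooth: "\<And>k i j. smooth_on X (\<gamma> k i j)" and X: "open X"
    and fi: "formally_integrable X \<omega> \<gamma>"
    and x: "x \<in> X" and u: "\<And>i j. lie_metric \<omega> i j x u = 0"
  shows "lie_metric (ricci \<gamma>) l j x u = 0"
proof -
  let ?L = "lie_connection \<gamma>"
  define \<Phi> :: equation where "\<Phi> = (\<lambda>x u. \<Sum>k\<in>UNIV.
     formal_deriv k (?L k l j) x u - formal_deriv j (?L k l k) x u
     + (\<Sum>s\<in>UNIV. \<gamma> k s k x * ?L s l j x u + \<gamma> s l j x * ?L k s k x u
        - \<gamma> k s j x * ?L s l k x u - \<gamma> s l k x * ?L k s j x u))"
  have eq: "\<Phi> x u = lie_metric (ricci \<gamma>) l j x u" if x: "x \<in> X" for x u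
  proof -
    have "pd r (ricci \<gamma> l j) x = (\<Sum>k\<in>UNIV. pd r (curvature \<gamma> k l k j) x)" for r
      unfolding ricci_def[abs_def] sum_2
      by (intro pd_add curvature_differentiable[OF smooth x])
    moreover have "\<Phi> x u = (\<Sum>k\<in>UNIV. \<Sum>r\<in>UNIV. curvature \<gamma> k r k j x * u r {#l#}
        + curvature \<gamma> k l r j x * u r {#k#} + curvature \<gamma> k l k r x * u r {#j#}
        - curvature \<gamma> r l k j x * u k {#r#} + u r {#} * pd r (curvature \<gamma> k l k j) x)"
      unfolding \<Phi>_def by (intro sum.cong refl lie_curvature[OF smooth X x])
    ultimately show ?thesis
      unfolding lie_metric_def by (simp add: ricci_def sum_2 algebra_simps)
  qed
  have "derived_eq X \<omega> \<gamma> \<Phi>"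
    unfolding \<Phi>_def
    by (intro derived_eq_sum derived_eq_diff derived_eq.intros smooth)
  \<comment> \<open>Although \<open>\<Phi>\<close> is written with third order jets, on
    \<open>X\<close> it equals the Lie derivative of the Ricci tensor, which involves only
    1-jets.\<close>
  moreover have "order_le X 1 \<Phi>"
    unfolding order_le_def by (auto simp: eq lie_metric_def intro!: sum.cong)
  ultimately have "consequence_of_metric X \<omega> \<Phi>"
    using fi unfolding formally_integrable_def by blast
  then show ?thesis
    using u x eq unfolding consequence_of_metric_def by metis
qed

section \<open>First order jets annihilating the metric\<close>

text \<open>Coordinates of order at least 2 get an irrelevant value.\<close>

definition first_jet :: "(2 \<Rightarrow> real) \<Rightarrow> (2 \<Rightarrow> 2 \<Rightarrow> real) \<Rightarrow> jet" where
  "first_jet v A k M = (if M = {#} then v k else if M = {#1#} then A k 1 else A k 2)"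

lemma first_jet_simps [simp]:
  "first_jet v A k {#} = v k" "first_jet v A k {#i#} = A k i"
  using exhaust_2[of i] by (auto simp: first_jet_def)

lemma det_mat_of: "det (mat_of \<omega> x) = \<omega> 1 1 x * \<omega> 2 2 x - \<omega> 1 2 x * \<omega> 2 1 x"
  by (simp add: det_2 mat_of_def)

text \<open>The jet used here spans the orthogonal Lie algebra of \<open>\<omega>\<close> at \<open>x\<close>.\<close>

lemma sym_part_proportional:
  assumes sym: "\<And>i j. \<omega> i j x = \<omega> j i x" and nz: "det (mat_of \<omega> x) \<noteq> 0"
    and inv: "\<And>u i j. (\<And>i j. lie_metric \<omega> i j x u = 0) \<Longrightarrow> lie_metric \<rho> i j x u = 0"
  shows "1/2 * (\<rho> i j x + \<rho> j i x) = (\<rho> 1 1 x * \<omega> 2 2 x - (\<rho> 1 2 x + \<rho> 2 1 x) * \<omega> 1 2 x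
    + \<rho> 2 2 x * \<omega> 1 1 x) / (2 * det (mat_of \<omega> x)) * \<omega> i j x"
proof -
  \<comment> \<open>Lowering the upper index gives \<open>\<omega> 1 j x * \<omega> 2 i x - \<omega>
    2 j x * \<omega> 1 i x\<close>, which is skew in \<open>i\<close> and \<open>j\<close>.\<close>
  define A :: "2 \<Rightarrow> 2 \<Rightarrow> real" where
    "A k i = (if k = 1 then \<omega> 2 i x else - \<omega> 1 i x)" for k i
  define u where "u = first_jet (\<lambda>_. 0) A"
  have s: "\<omega> 2 1 x = \<omega> 1 2 x" by (rule sym)
  have "\<forall>i j. lie_metric \<omega> i j x u = 0"
    unfolding forall_2 lie_metric_def sum_2 u_def by (simp add: A_def s)
  then have z: "lie_metric \<rho> i j x u = 0" for i j
    using inv by blast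
  \<comment> \<open>\<open>e1\<close>, \<open>e2\<close>, \<open>e3\<close> are the vanishing 2 by 2
    minors of the component vectors of the symmetric part of \<open>\<rho>\<close> and of
    \<open>\<omega>\<close>: the two are proportional.\<close>
  have e1: "(\<rho> 1 2 x + \<rho> 2 1 x) * \<omega> 1 1 x = 2 * \<rho> 1 1 x * \<omega> 1 2 x"
    using z[of 1 1] by (simp add: lie_metric_def sum_2 u_def A_def s algebra_simps)
  have e2: "(\<rho> 1 2 x + \<rho> 2 1 x) * \<omega> 2 2 x = 2 * \<rho> 2 2 x * \<omega> 1 2 x"
    using z[of 2 2] by (simp add: lie_metric_def sum_2 u_def A_def s algebra_simps)
  have e3: "\<rho> 1 1 x * \<omega> 2 2 x = \<rho> 2 2 x * \<omega> 1 1 x"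
    using z[of 1 2] by (simp add: lie_metric_def sum_2 u_def A_def s algebra_simps)
  have D: "det (mat_of \<omega> x) = \<omega> 1 1 x * \<omega> 2 2 x - \<omega> 1 2 x * \<omega> 1 2 x"
    by (simp add: det_mat_of s)
  \<comment> \<open>By the adjugate formula, \<open>n / det (mat_of \<omega> x)\<close> is the trace
    of \<open>\<rho>\<close> with respect to \<open>\<omega>\<close>; the factor of proportionality
    is half of it.\<close>
  define n where "n = \<rho> 1 1 x * \<omega> 2 2 x - (\<rho> 1 2 x + \<rho> 2 1 x) * \<omega> 1 2 x + \<rho> 2 2 x * \<omega> 1 1 x"
  have "\<forall>i j. (\<rho> i j x + \<rho> j i x) * det (mat_of \<omega> x) = n * \<omega> i j x"
    unfolding n_def forall_2 D s using e1 e2 e3 by algebra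
  then have "\<rho> i j x + \<rho> j i x = n * \<omega> i j x / det (mat_of \<omega> x)"
    using nz by (simp add: eq_divide_eq)
  then show ?thesis by (simp add: n_def)
qed

lemma metric_first_jet_exists:
  assumes sym: "\<And>i j. \<omega> i j x = \<omega> j i x" and nz: "det (mat_of \<omega> x) \<noteq> 0"
    and psym: "\<And>i j. pd r (\<omega> i j) x = pd r (\<omega> j i) x"
  shows "\<exists>A. \<forall>i j. lie_metric \<omega> i j x (first_jet (\<lambda>k. if k = r then 1 else 0) A) = 0"
proof -
  define D where "D = det (mat_of \<omega> x)"
  \<comment> \<open>Cramer's rule for the system stated in \<open>half\<close>: each of the two
    first order terms of \<open>lie_metric\<close> then contributes minus half the derivative of
    \<open>\<omega>\<close>.\<close>
  define A :: "2 \<Rightarrow> 2 \<Rightarrow> real" where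
    "A k i = (if k = 1 then \<omega> 1 2 x * pd r (\<omega> 2 i) x - \<omega> 2 2 x * pd r (\<omega> 1 i) x
       else \<omega> 1 2 x * pd r (\<omega> 1 i) x - \<omega> 1 1 x * pd r (\<omega> 2 i) x) / (2 * D)" for k i
  have s: "\<omega> 2 1 x = \<omega> 1 2 x" "pd r (\<omega> 2 1) x = pd r (\<omega> 1 2) x"
    by (rule sym psym)+
  have D: "D = \<omega> 1 1 x * \<omega> 2 2 x - \<omega> 1 2 x * \<omega> 1 2 x" "D \<noteq> 0"
    using nz by (simp_all add: D_def det_mat_of s)
  have half: "(\<Sum>k\<in>UNIV. \<omega> k j x * A k i) = - pd r (\<omega> j i) x / 2" for i j
  proof -
    have "\<forall>j. (\<Sum>k\<in>UNIV. \<omega> k j x * (A k i * (2 * D))) = - pd r (\<omega> j i) x * D"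
      using \<open>D \<noteq> 0\<close> unfolding forall_2 sum_2
      by (simp add: A_def s) (simp add: D algebra_simps)
    then have "2 * D * (\<Sum>k\<in>UNIV. \<omega> k j x * A k i) = 2 * D * (- pd r (\<omega> j i) x / 2)"
      by (simp add: sum_2 algebra_simps)
    then show ?thesis
      using \<open>D \<noteq> 0\<close> by (subst (asm) mult_left_cancel) simp_all
  qed
  have "lie_metric \<omega> i j x (first_jet (\<lambda>k. if k = r then 1 else 0) A) = 0" for i j
  proof -
    have "lie_metric \<omega> i j x (first_jet (\<lambda>k. if k = r then 1 else 0) A)
      = (\<Sum>k\<in>UNIV. \<omega> k j x * A k i) + (\<Sum>k\<in>UNIV. \<omega> k i x * A k j) + pd r (\<omega> i j) x"
      using exhaust_2[of r] by (auto simp: lie_metric_def sum_2 sym[of i])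
    then show ?thesis
      by (simp add: half psym[of j i])
  qed
  then show ?thesis by blast
qed

lemma constant_if_pd_eq_0:
  assumes "open X" "connected X" "\<And>x. x \<in> X \<Longrightarrow> f differentiable at x"
    and "\<And>x i. x \<in> X \<Longrightarrow> pd i f x = 0"
  shows "\<exists>c. \<forall>x\<in>X. f x = c"
proof -
  have "(f has_derivative (\<lambda>h. 0)) (at x)" if "x \<in> X" for x
    using has_derivative_pd[OF assms(3)[OF that]] assms(4)[OF that] by simp
  then show ?thesis
    using has_derivative_zero_unique_connected[OF assms(1,2)] by metis
qed

section \<open>Symmetry of the Ricci tensor of the Levi-Civita connection\<close>

text \<open>Jacobi's formula: the trace is half the logarithmic derivative of the determinant.
  Multiplying by the determinant avoids the logarithm and the sign of \<open>det\<close>.\<close>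

lemma levi_civita_trace:
  assumes sym: "\<And>i j. \<omega> i j x = \<omega> j i x" and nz: "det (mat_of \<omega> x) \<noteq> 0"
    and psym: "\<And>r i j. pd r (\<omega> i j) x = pd r (\<omega> j i) x"
  shows "2 * det (mat_of \<omega> x) * (\<Sum>k\<in>UNIV. levi_civita \<omega> k i k x)
    = pd i (\<omega> 1 1) x * \<omega> 2 2 x + \<omega> 1 1 x * pd i (\<omega> 2 2) x - 2 * \<omega> 1 2 x * pd i (\<omega> 1 2) x"
proof -
  let ?M = "mat_of \<omega> x"
  define B where "B = matrix_inv ?M"
  have s: "\<omega> 2 1 x = \<omega> 1 2 x" "\<And>r. pd r (\<omega> 2 1) x = pd r (\<omega> 1 2) x"
    by (rule sym psym)+
  have "?M ** B = mat 1"
    unfolding B_def matrix_inv_def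
  proof (rule conjunct1[OF someI_ex])
    show "\<exists>B. ?M ** B = mat 1 \<and> B ** ?M = mat 1"
      using nz by (simp only: invertible_det_nz[symmetric] invertible_def)
  qed
  then have "\<forall>i j. (?M ** B) $ i $ j = mat 1 $ i $ j" by simp
  then have B: "\<omega> 1 1 x * B $ 1 $ 1 + \<omega> 1 2 x * B $ 2 $ 1 = 1"
    "\<omega> 1 1 x * B $ 1 $ 2 + \<omega> 1 2 x * B $ 2 $ 2 = 0"
    "\<omega> 1 2 x * B $ 1 $ 1 + \<omega> 2 2 x * B $ 2 $ 1 = 0"
    "\<omega> 1 2 x * B $ 1 $ 2 + \<omega> 2 2 x * B $ 2 $ 2 = 1"
    unfolding forall_2 by (simp_all add: matrix_matrix_mult_def sum_2 mat_def mat_of_def s)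
  have D: "det ?M = \<omega> 1 1 x * \<omega> 2 2 x - \<omega> 1 2 x * \<omega> 1 2 x"
    by (simp add: det_mat_of s)
  have DB: "det ?M * B $ 1 $ 1 = \<omega> 2 2 x" "det ?M * B $ 1 $ 2 = - \<omega> 1 2 x"
    "det ?M * B $ 2 $ 1 = - \<omega> 1 2 x" "det ?M * B $ 2 $ 2 = \<omega> 1 1 x"
    unfolding D using B by algebra+
  \<comment> \<open>The last summand, with \<open>B $ 1 $ 2 - B $ 2 $ 1\<close>, vanishes once the
    inverse matrix is known to be symmetric.\<close>
  have "\<forall>i. 2 * (\<Sum>k\<in>UNIV. levi_civita \<omega> k i k x)
    = B $ 1 $ 1 * pd i (\<omega> 1 1) x + (B $ 1 $ 2 + B $ 2 $ 1) * pd i (\<omega> 1 2) x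
       + B $ 2 $ 2 * pd i (\<omega> 2 2) x + (B $ 1 $ 2 - B $ 2 $ 1) * (pd 1 (\<omega> i 2) x - pd 2 (\<omega> i 1) x)"
    unfolding forall_2 by (simp add: levi_civita_def sum_2 B_def[symmetric] s algebra_simps)
  moreover have "B $ 1 $ 2 = B $ 2 $ 1"
    using DB(2,3) nz by (metis mult_left_cancel)
  ultimately have "2 * (\<Sum>k\<in>UNIV. levi_civita \<omega> k i k x)
    = B $ 1 $ 1 * pd i (\<omega> 1 1) x + 2 * B $ 1 $ 2 * pd i (\<omega> 1 2) x + B $ 2 $ 2 * pd i (\<omega> 2 2) x"
    by simp
  then show ?thesis using DB by algebra
qed

text \<open>Without torsion, the divergence term and the quadratic terms of the Ricci tensor are
  symmetric. Only the derivatives of the trace form survive, as its exterior derivative.\<close>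

lemma ricci_skew_part:
  assumes smooth: "\<And>k i j. smooth_on X (\<gamma> k i j)" and X: "open X" and x: "x \<in> X"
    and sym: "\<And>k i j x. x \<in> X \<Longrightarrow> \<gamma> k i j x = \<gamma> k j i x"
  shows "ricci \<gamma> i j x - ricci \<gamma> j i x
    = pd i (\<lambda>y. \<Sum>k\<in>UNIV. \<gamma> k j k y) x - pd j (\<lambda>y. \<Sum>k\<in>UNIV. \<gamma> k i k y) x"
proof -
  have psym: "pd r (\<gamma> k i j) x = pd r (\<gamma> k j i) x" for r k i j
    using X x sym by (rule pd_cong_open)
  have "pd r (\<lambda>y. \<Sum>k\<in>UNIV. \<gamma> k i k y) x = (\<Sum>k\<in>UNIV. pd r (\<gamma> k i k) x)" for r i
    unfolding sum_2 by (intro pd_add smooth_on_differentiable[OF smooth x])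
  then show ?thesis
    by (simp add: ricci_def curvature_def sum_2 psym[of _ _ j i] sym[OF x, of _ j i]
        sym[OF x, of _ 1 i] sym[OF x, of _ 2 i] sym[OF x, of _ 1 j] sym[OF x, of _ 2 j]
        sym[OF x, of _ 2 1])
qed

lemma levi_civita_ricci_symmetric:
  assumes X: "open X" and x: "x \<in> X"
    and smooth_\<omega>: "\<And>i j. smooth_on X (\<omega> i j)"
    and sym_\<omega>: "\<And>i j x. x \<in> X \<Longrightarrow> \<omega> i j x = \<omega> j i x"
    and nz: "\<And>x. x \<in> X \<Longrightarrow> det (mat_of \<omega> x) \<noteq> 0"
    and smooth: "\<And>k i j. smooth_on X (\<gamma> k i j)"
    and sym: "\<And>k i j x. x \<in> X \<Longrightarrow> \<gamma> k i j x = \<gamma> k j i x"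
    and LC: "\<And>k i j x. x \<in> X \<Longrightarrow> \<gamma> k i j x = levi_civita \<omega> k i j x"
  shows "ricci \<gamma> i j x = ricci \<gamma> j i x"
proof -
  define D where "D y = det (mat_of \<omega> y)" for y
  define g where "g i y = (\<Sum>k\<in>UNIV. \<gamma> k i k y)" for i y
  define E where "E i y = pd i (\<omega> 1 1) y * \<omega> 2 2 y + \<omega> 1 1 y * pd i (\<omega> 2 2) y
    - 2 * \<omega> 1 2 y * pd i (\<omega> 1 2) y" for i y
  note [simp] = smooth_on_differentiable[OF smooth_\<omega> x] smooth_on_differentiable[OF smooth x]
    smooth_on_differentiable[OF smooth_on_pd[OF smooth_\<omega>] x]
  have psym: "pd r (\<omega> i j) x = pd r (\<omega> j i) x" if "x \<in> X" for r i j x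
    using X that sym_\<omega> by (rule pd_cong_open)
  have D': "D = (\<lambda>y. \<omega> 1 1 y * \<omega> 2 2 y - \<omega> 1 2 y * \<omega> 2 1 y)"
    by (auto simp: D_def det_mat_of)
  have [simp]: "D differentiable at x" unfolding D' by simp
  have [simp]: "g i differentiable at x" for i unfolding g_def sum_2 by simp
  have trace: "2 * (D y * g i y) = E i y" if "y \<in> X" for i y
    using levi_civita_trace[OF sym_\<omega>[OF that] nz[OF that] psym[OF that]] that
    by (simp add: D_def g_def E_def LC mult.assoc)
  have "pd j D x = E j x" for j
    by (simp add: D' pd_diff pd_mult E_def sym_\<omega>[OF x, of 2 1] psym[OF x, of _ 2 1])
  then have pdD: "pd j D x = 2 * (D x * g j x)" for j
    using trace[OF x] by simp
  have "pd j (E i) x = 2 * (D x * pd j (g i) x + pd j D x * g i x)" for i j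
  proof -
    have "pd j (E i) x = pd j (\<lambda>y. 2 * (D y * g i y)) x"
      using X x by (rule pd_cong_open) (simp add: trace)
    then show ?thesis by (simp add: pd_mult)
  qed
  moreover have "pd j (E i) x = pd i (E j) x" for i j
    unfolding E_def
    by (simp add: pd_add pd_diff pd_mult pd_commute[OF smooth_\<omega> X x, of j i])
  \<comment> \<open>With \<open>pd j D x\<close> replaced by \<open>2 * (D x * g j x)\<close>, the
    products of \<open>g i\<close> and \<open>g j\<close> are symmetric and drop out.\<close>
  ultimately have "D x * (pd i (g j) x - pd j (g i) x) = 0"
    unfolding pdD by (simp add: algebra_simps)
  then have "pd i (g j) x = pd j (g i) x"
    using nz[OF x] by (simp add: D_def)
  moreover have "ricci \<gamma> i j x - ricci \<gamma> j i x = pd i (g j) x - pd j (g i) x"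
    unfolding g_def[abs_def] using smooth X x sym by (rule ricci_skew_part)
  ultimately show ?thesis by simp
qed

section \<open>The Vessiot structure equations\<close>

theorem mainTheorem1:
  fixes X :: "(real^2) set" and \<omega> :: sym2 and \<gamma> :: connection
  assumes "open X" and "connected X"
    and "\<And>i j. smooth_on X (\<omega> i j)"
    and "\<And>i j x. x \<in> X \<Longrightarrow> \<omega> i j x = \<omega> j i x"
    and "\<And>x. x \<in> X \<Longrightarrow> det (mat_of \<omega> x) \<noteq> 0"
    and "\<And>k i j. smooth_on X (\<gamma> k i j)"
    and "\<And>k i j x. x \<in> X \<Longrightarrow> \<gamma> k i j x = \<gamma> k j i x"
    and "formally_integrable X \<omega> \<gamma>"
  shows "\<exists>c1 c2 :: real.
    (\<forall>x\<in>X. (\<forall>i j. 1/2 * (ricci \<gamma> i j x + ricci \<gamma> j i x) = c1 * \<omega> i j x)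
        \<and> 1/2 * (ricci \<gamma> 1 2 x - ricci \<gamma> 2 1 x) = c2 * sqrt \<bar>det (mat_of \<omega> x)\<bar>)
    \<and> ((\<forall>x\<in>X. \<forall>k i j. \<gamma> k i j x = levi_civita \<omega> k i j x) \<longrightarrow>
        c2 = 0 \<and> (\<forall>x\<in>X. \<forall>i j. ricci \<gamma> i j x = ricci \<gamma> j i x \<and> ricci \<gamma> i j x = c1 * \<omega> i j x))"
proof (cases "X = {}")
  case True
  \<comment> \<open>Over the empty set the constants are unconstrained except for the clause
    \<open>c2 = 0\<close>, so the value 0 is chosen.\<close>
  then show ?thesis by (intro exI[of _ 0]) simp
next
  case False
  then obtain p where p: "p \<in> X" by blast
  note X = assms(1) and smooth_\<omega> = assms(3) and sym = assms(4) and nz = assms(5)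
    and smooth = assms(6)
  let ?R = "ricci \<gamma>"
  define D where "D x = det (mat_of \<omega> x)" for x
  define N where "N x = ?R 1 2 x - ?R 2 1 x" for x
  \<comment> \<open>\<open>w\<close> is the area density of \<open>\<omega>\<close>,
    \<open>f\<close> is half the trace of the Ricci tensor, and \<open>q\<close> is the ratio of its
    skew part to \<open>w\<close>.\<close>
  define w where "w x = sqrt \<bar>D x\<bar>" for x
  define f where "f x = (?R 1 1 x * \<omega> 2 2 x - (?R 1 2 x + ?R 2 1 x) * \<omega> 1 2 x
    + ?R 2 2 x * \<omega> 1 1 x) / (2 * D x)" for x
  define q where "q x = N x / (2 * w x)" for x
  have D': "D = (\<lambda>y. \<omega> 1 1 y * \<omega> 2 2 y - \<omega> 1 2 y * \<omega> 2 1 y)"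
    by (auto simp: D_def det_mat_of)
  have D0: "D x \<noteq> 0" and w0: "w x \<noteq> 0" if "x \<in> X" for x
    using nz[OF that] by (simp_all add: D_def w_def)
  have dom: "\<omega> i j differentiable at x" and dR: "?R i j differentiable at x"
    and dD: "D differentiable at x" and dN: "N differentiable at x" if "x \<in> X" for i j x
    using smooth_on_differentiable[OF smooth_\<omega> that] ricci_differentiable[OF smooth that]
    by (simp_all add: D' N_def[abs_def])
  have dw: "w differentiable at x" if "x \<in> X" for x
  proof -
    have "(\<lambda>x. norm (D x)) differentiable at x"
      using dD[OF that] D0[OF that] by (intro differentiable_compose[of norm "D"] differentiable_norm_at)
    moreover have "sqrt differentiable at (norm (D x))"
      using D0[OF that] DERIV_real_sqrt[of "norm (D x)"] real_differentiable_def by auto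
    ultimately show ?thesis
      using differentiable_compose[of sqrt "\<lambda>x. norm (D x)" x UNIV] by (simp add: w_def[abs_def])
  qed
  have df: "f differentiable at x" and dq: "q differentiable at x" if "x \<in> X" for x
    unfolding f_def[abs_def] q_def[abs_def]
    using dom[OF that] dR[OF that] dD[OF that] dN[OF that] dw[OF that] D0[OF that] w0[OF that]
    by (intro differentiable_divide differentiable_add differentiable_diff differentiable_mult
        differentiable_const; simp)+
  have psym: "pd r (\<omega> i j) x = pd r (\<omega> j i) x" if "x \<in> X" for r i j x
    using X that sym by (rule pd_cong_open)
  have inv: "lie_metric ?R i j x u = 0"
    if "x \<in> X" "\<And>i j. lie_metric \<omega> i j x u = 0" for x u i j
    using smooth X assms(8) that by (rule lie_ricci_consequence)
  have sym_part: "?R i j x + ?R j i x = 2 * (f x * \<omega> i j x)" if "x \<in> X" for i j x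
  proof -
    have "1/2 * (?R i j x + ?R j i x) = (?R 1 1 x * \<omega> 2 2 x - (?R 1 2 x + ?R 2 1 x) * \<omega> 1 2 x
        + ?R 2 2 x * \<omega> 1 1 x) / (2 * det (mat_of \<omega> x)) * \<omega> i j x"
      using sym[OF that] nz[OF that] inv[OF that] by (rule sym_part_proportional)
    then show ?thesis by (simp add: f_def D_def)
  qed
  have jets: "pd r f x = 0" "pd r q x = 0" if x: "x \<in> X" for r x
  proof -
    note [simp] = dom[OF x] dR[OF x] dD[OF x] dN[OF x] dw[OF x] df[OF x] dq[OF x]
    let ?v = "\<lambda>k. if k = r then 1 else (0::real)"
    \<comment> \<open>A 1-jet annihilating \<open>\<omega>\<close> whose value is the
      \<open>r\<close>-th unit vector: its Lie derivatives contain exactly the derivative along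
      \<open>r\<close>, as \<open>expand\<close> shows.\<close>
    obtain A where A: "\<And>i j. lie_metric \<omega> i j x (first_jet ?v A) = 0"
      using metric_first_jet_exists[of \<omega> x r] sym[OF x] nz[OF x] psym[OF x] by auto
    have expand: "lie_metric \<rho> i j x (first_jet ?v A)
        = (\<Sum>k\<in>UNIV. \<rho> k j x * A k i + \<rho> i k x * A k j) + pd r (\<rho> i j) x" for \<rho> :: sym2 and i j
      using exhaust_2[of r] by (auto simp: lie_metric_def sum_2)
    have a: "(\<Sum>k\<in>UNIV. \<omega> k j x * A k i + \<omega> i k x * A k j) + pd r (\<omega> i j) x = 0" for i j
      using A[of i j] by (simp add: expand)
    have b: "(\<Sum>k\<in>UNIV. ?R k j x * A k i + ?R i k x * A k j) + pd r (?R i j) x = 0" for i j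
      using inv[OF x A, of i j] by (simp add: expand)
    have df0: "pd r f x * \<omega> i j x = 0" for i j
    proof -
      have "pd r (?R i j) x + pd r (?R j i) x = pd r (\<lambda>x. ?R i j x + ?R j i x) x"
        by (simp add: pd_add)
      also have "\<dots> = pd r (\<lambda>x. 2 * (f x * \<omega> i j x)) x"
        using X x by (rule pd_cong_open) (rule sym_part)
      also have "\<dots> = 2 * (f x * pd r (\<omega> i j) x + pd r f x * \<omega> i j x)"
        by (simp add: pd_mult)
      finally have 1: "pd r (?R i j) x + pd r (?R j i) x
        = 2 * (f x * pd r (\<omega> i j) x + pd r f x * \<omega> i j x)" .
      have "(\<Sum>k\<in>UNIV. (?R k j x + ?R j k x) * A k i + (?R i k x + ?R k i x) * A k j)
          + (pd r (?R i j) x + pd r (?R j i) x) = 0"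
        using b[of i j] b[of j i] by (simp add: sum_2 algebra_simps)
      then have "f x * ((\<Sum>k\<in>UNIV. \<omega> k j x * A k i + \<omega> i k x * A k j) + pd r (\<omega> i j) x)
          + pd r f x * \<omega> i j x = 0"
        unfolding 1 sym_part[OF x] by (simp add: sum_2 algebra_simps)
      then show ?thesis by (simp only: a)
    qed
    have "pd r f x * D x = (pd r f x * \<omega> 1 1 x) * \<omega> 2 2 x - (pd r f x * \<omega> 1 2 x) * \<omega> 2 1 x"
      by (simp add: D' algebra_simps)
    then have "pd r f x * D x = 0"
      unfolding df0 by simp
    then have f0: "pd r f x = 0"
      using D0[OF x] by simp
    \<comment> \<open>\<open>t\<close> is the divergence of the jet. Invariance makes
      \<open>D\<close>, \<open>N\<close> and \<open>w\<close> scale with it as densities: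
      \<open>pD\<close> has weight 2, \<open>pN\<close> and \<open>pw\<close> have weight 1, so the
      quotient \<open>q\<close> has derivative zero.\<close>
    define t where "t = A 1 1 + A 2 2"
    have "pd r D x = \<omega> 1 1 x * pd r (\<omega> 2 2) x + pd r (\<omega> 1 1) x * \<omega> 2 2 x
      - 2 * \<omega> 1 2 x * pd r (\<omega> 1 2) x"
      by (simp add: D' pd_diff pd_mult sym[OF x, of 2 1] psym[OF x, of r 2 1])
    moreover have "D x = \<omega> 1 1 x * \<omega> 2 2 x - \<omega> 1 2 x * \<omega> 1 2 x"
      by (simp add: D' sym[OF x, of 2 1])
    ultimately have pD: "pd r D x = - 2 * D x * t"
      using a[of 1 1] a[of 1 2] a[of 2 2]
      unfolding t_def sum_2 sym[OF x, of 2 1] psym[OF x, of r 2 1] by algebra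
    have "pd r N x = pd r (?R 1 2) x - pd r (?R 2 1) x"
      by (simp add: N_def[abs_def] pd_diff)
    then have pN: "pd r N x = - N x * t"
      using b[of 1 2] b[of 2 1] unfolding t_def N_def sum_2 by algebra
    \<comment> \<open>Differentiating the fourth power of \<open>w\<close>, which is
      \<open>D y * D y\<close>, avoids differentiating the absolute value.\<close>
    have "pd r (\<lambda>y. (w y * w y) * (w y * w y)) x = pd r (\<lambda>y. D y * D y) x"
      using X x by (rule pd_cong_open) (simp add: w_def)
    then have "4 * (w x * w x) * w x * pd r w x = 2 * D x * pd r D x"
      by (simp add: pd_mult algebra_simps)
    moreover have ww: "(w x * w x) * (w x * w x) = D x * D x"
      by (simp add: w_def)
    ultimately have "(4 * (D x * D x)) * pd r w x = (4 * (D x * D x)) * (- t * w x)"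
      unfolding pD by algebra
    then have pw: "pd r w x = - t * w x"
      using D0[OF x] by (subst (asm) mult_left_cancel) simp_all
    have "pd r N x = pd r (\<lambda>y. 2 * (q y * w y)) x"
      using X x by (rule pd_cong_open) (use w0 in \<open>simp add: q_def\<close>)
    also have "\<dots> = 2 * (q x * pd r w x + pd r q x * w x)"
      by (simp add: pd_mult)
    finally have "pd r q x * w x = 0"
      unfolding pN pw using w0[OF x] by (simp add: q_def)
    then show "pd r q x = 0" using w0[OF x] by simp
    show "pd r f x = 0" by (rule f0)
  qed
  obtain c1 where c1: "\<forall>x\<in>X. f x = c1"
    using constant_if_pd_eq_0[OF assms(1,2) df jets(1)] by auto
  obtain c2 where c2: "\<forall>x\<in>X. q x = c2"
    using constant_if_pd_eq_0[OF assms(1,2) dq jets(2)] by auto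
  have main: "1/2 * (?R i j x + ?R j i x) = c1 * \<omega> i j x" if "x \<in> X" for i j x
    using sym_part[OF that] c1 that by simp
  have skew: "1/2 * (?R 1 2 x - ?R 2 1 x) = c2 * sqrt \<bar>det (mat_of \<omega> x)\<bar>" if "x \<in> X" for x
    using c2 that w0[OF that] by (auto simp: q_def N_def w_def D_def)
  have LC: "c2 = 0 \<and> (\<forall>x\<in>X. \<forall>i j. ?R i j x = ?R j i x \<and> ?R i j x = c1 * \<omega> i j x)"
    if "\<forall>x\<in>X. \<forall>k i j. \<gamma> k i j x = levi_civita \<omega> k i j x"
  proof -
    have Rsym: "?R i j x = ?R j i x" if "x \<in> X" for i j x
      using X that smooth_\<omega> sym nz smooth assms(7)
      by (rule levi_civita_ricci_symmetric) (simp_all add: \<open>\<forall>x\<in>X. \<forall>k i j. \<gamma> k i j x = levi_civita \<omega> k i j x\<close>)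
    \<comment> \<open>One point suffices: the skew part vanishes at \<open>p\<close>, while the area
      density does not.\<close>
    have "c2 = 0"
      using skew[OF p] Rsym[OF p, of 1 2] nz[OF p] by simp
    then show ?thesis using Rsym main by force
  qed
  show ?thesis using main skew LC by (intro exI[of _ c1] exI[of _ c2]) simp
qed

end
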